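(* Let $t\ge2$, let $n_1,\dots,n_{t+1}\ge1$, let $\Delta_l$ be a partition of $\langle n_l\rangle$ for $l=1,\dots,t+1$, and let $P_l\in\widehat{G}_{\Delta_l,\Delta_{l+1}}\subseteq C_{n_l,n_{l+1}}$ for $l=1,\dots,t$. Suppose that $$\Delta_1=(\langle n_1\rangle)\quad\text{and}\quad \Delta_{t+1}=(\{j\},K^c)_{j\in K}$$ for some $\emptyset\neq K\subseteq\langle n_{t+1}\rangle$, where $K^c=\langle n_{t+1}\rangle\setminus K$ (both $|K^c|\le1$ and $|K^c|>1$ are allowed). Then: (a) $(P_1P_2\cdots P_t)^K$ (equivalently, $P_1P_2\cdots P_{t-1}P_t^K$) is a stable matrix, i.e. all its rows are identical; (b) for every $i\in\langle n_1\rangle$, the $i$-th row of $(P_1P_2\cdots P_t)^K$ satisfies $$(P_1P_2\cdots P_t)_{\{i\}}^K=\left(P_1^{-+}P_2^{-+}\cdots P_t^{-+}\right)^{\bigcup_{j\in K}\{\{j\}\}}=P_1^{-+}P_2^{-+}\cdots P_{t-1}^{-+}\left(P_t^K\right)^{-+},$$ where $P_b^{-+}=P_b^{-+(\Delta_b,\Delta_{b+1})}$ for $b\in\langle t\rangle$ and $(P_t^K)^{-+}=(P_t^K)^{-+(\Delta_t,(\{j\})_{j\in K})}$; (c) with $e=e(n_1)=(1,1,\dots,1)\in\mathbb{R}^{n_1}$, $$(P_1P_2\cdots P_t)^K=e'\left(P_1^{-+}P_2^{-+}\cdots P_t^{-+}\right)^{\bigcup_{j\in K}\{\{j\}\}}=e'P_1^{-+}P_2^{-+}\cdots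 P_{t-1}^{-+}\left(P_t^K\right)^{-+}.$$ In particular, if $K=\langle n_{t+1}\rangle$, then $P_1P_2\cdots P_t$ is a stable matrix, $(P_1P_2\cdots P_t)_{\{i\}}=P_1^{-+}P_2^{-+}\cdots P_t^{-+}$ for all $i\in\langle n_1\rangle$, and $P_1P_2\cdots P_t=e'P_1^{-+}P_2^{-+}\cdots P_t^{-+}$.
   Context: For $m\ge1$, $\langle m\rangle=\{1,2,\dots,m\}$. $C_{m,n}$ is the set of complex $m\times n$ matrices. Vectors are row vectors; $e'$ is the transpose of $e$. Partitions do not contain the empty set; $(\langle m\rangle)$ is the one-block partition of $\langle m\rangle$, and $(\{j\},K^c)_{j\in K}$ is the partition consisting of the singletons $\{j\}$, $j\in K$, together with the block $K^c$ if $K^c\ne\emptyset$ (so it is the partition into singletons if $|K^c|\le1$). For a matrix $P\in C_{m,n}$ and nonempty $U\subseteq\langle m\rangle$, $V\subseteq\langle n\rangle$: $P_U=(P_{ij})_{i\in U,j\in\langle n\rangle}$, $P^V=(P_{ij})_{i\in\langle m\rangle,j\in V}$, $P_U^V=(P_{ij})_{i\in U,j\in V}$. The same superscript notation is used for matrices whose columns are indexed by sets: $Q^{\bigcup_{j\in K}\{\{j\}\}}$ is the submatrix of $Q$ formed by the columns labelled $\{j\}$, $j\in K$. A complex matrix is *generalized stochastic* if all its row sums equal one and the same $a\in\mathbb{C}$ ($a=0$ allowed). For partitions $\Delta$ of $\langle m\rangle$ and $\Sigma$ of $\langle n\rangle$, $P\in C_{m,n}$ is *$[\Delta]$-stable on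 $\Sigma$* if $P_U^V$ is generalized stochastic for all $U\in\Delta$, $V\in\Sigma$; $\widehat{G}_{\Delta,\Sigma}$ is the set of all such $P$. A matrix is *stable* if it is $[(\langle m\rangle)]$-stable on the partition of its column index set into singletons, i.e. if all its rows are identical. For $P\in\widehat{G}_{\Delta,\Sigma}$, the *grouped matrix* $P^{-+}=P^{-+(\Delta,\Sigma)}$ has rows indexed by $U\in\Delta$, columns indexed by $V\in\Sigma$, and entry $(U,V)$ equal to the common value $\sum_{j\in V}P_{ij}$, $i\in U$. The same definition is applied to $P_t^K$, whose columns are indexed by $K$ and whose column partition is $(\{j\})_{j\in K}$. Equalities between a matrix with a row labelled $i$ and columns labelled $j\in K$ and a matrix with a row labelled $\langle n_1\rangle$ and columns labelled $\{j\}$, $j\in K$, are understood up to identifying the row labels and identifying column $j$ with column $\{j\}$ for each $j\in K$; thus (b) says $(P_1\cdots P_t)_{ij}=(P_1^{-+}\cdots P_t^{-+})_{\langle n_1\rangle\{j\}}=(P_1^{-+}\cdots P_{t-1}^{-+}(P_t^K)^{-+})_{\langle n_1\rangle\{j\}}$ for all $i\in\langle n_1\rangle$, $j\in K$, and similarly for (c). *)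

theory Defs
  imports Complex_Main "HOL-Library.Disjoint_Sets"
begin

text \<open>
  Complex matrices whose rows and columns are labelled by the elements of two sets.  Labels are part
  of the data because columns of a submatrix keep their labels and because grouped matrices have
  rows and columns labelled by blocks of partitions.  The entry function vanishes off the index sets,
  so that HOL equality is equality of labelled matrices.
\<close>

typedef ('a, 'b) lmat =
  "{(R, C, f). \<forall>i j. i \<notin> R \<or> j \<notin> C \<longrightarrow> f i j = 0} :: ('a set \<times> 'b set \<times> ('a \<Rightarrow> 'b \<Rightarrow> complex)) set"
  by (rule exI[of _ "({}, {}, \<lambda>_ _. 0)"]) simp

setup_lifting type_definition_lmat

lift_definition rows :: "('a, 'b) lmat \<Rightarrow> 'a set" is "\<lambda>(R, C, f). R" .
lift_definition cols :: "('a, 'b) lmat \<Rightarrow> 'b set" is "\<lambda>(R, C, f). C" .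
lift_definition entry :: "('a, 'b) lmat \<Rightarrow> 'a \<Rightarrow> 'b \<Rightarrow> complex" is "\<lambda>(R, C, f). f" .

lift_definition lmat :: "'a set \<Rightarrow> 'b set \<Rightarrow> ('a \<Rightarrow> 'b \<Rightarrow> complex) \<Rightarrow> ('a, 'b) lmat"
  is "\<lambda>R C f. (R, C, \<lambda>i j. if i \<in> R \<and> j \<in> C then f i j else 0)"
  by auto

lemma rows_lmat [simp]: "rows (lmat R C f) = R"
  by transfer simp

lemma cols_lmat [simp]: "cols (lmat R C f) = C"
  by transfer simp

lemma entry_lmat: "entry (lmat R C f) i j = (if i \<in> R \<and> j \<in> C then f i j else 0)"
  by transfer simp

lemma lmat_eqI:
  assumes "rows A = rows B" and "cols A = cols B"
    and "\<And>i j. i \<in> rows A \<Longrightarrow> j \<in> cols A \<Longrightarrow> entry A i j = entry B i j"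
  shows "A = B"
  using assms
proof transfer
  fix A B :: "'a set \<times> 'b set \<times> ('a \<Rightarrow> 'b \<Rightarrow> complex)"
  obtain R C f R' C' g where [simp]: "A = (R, C, f)" "B = (R', C', g)"
    by (metis prod_cases3)
  assume "A \<in> {(R, C, f). \<forall>i j. i \<notin> R \<or> j \<notin> C \<longrightarrow> f i j = 0}"
    "B \<in> {(R, C, f). \<forall>i j. i \<notin> R \<or> j \<notin> C \<longrightarrow> f i j = 0}"
    "(case A of (R, C, f) \<Rightarrow> R) = (case B of (R, C, f) \<Rightarrow> R)"
    "(case A of (R, C, f) \<Rightarrow> C) = (case B of (R, C, f) \<Rightarrow> C)"
    "\<And>i j. i \<in> (case A of (R, C, f) \<Rightarrow> R) \<Longrightarrow> j \<in> (case A of (R, C, f) \<Rightarrow> C) \<Longrightarrow>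
      (case A of (R, C, f) \<Rightarrow> f) i j = (case B of (R, C, f) \<Rightarrow> f) i j"
  then have eq: "R' = R" "C' = C" and off: "\<And>i j. i \<notin> R \<or> j \<notin> C \<Longrightarrow> f i j = 0 \<and> g i j = 0"
    and on: "\<And>i j. i \<in> R \<Longrightarrow> j \<in> C \<Longrightarrow> f i j = g i j"
    by simp_all
  have "f i j = g i j" for i j
    using off[of i j] on[of i j] by argo
  then show "A = B"
    using eq by (simp add: fun_eq_iff)
qed

definition C_mat :: "nat \<Rightarrow> nat \<Rightarrow> (nat, nat) lmat set" where
  "C_mat m n = {P. rows P = {1..m} \<and> cols P = {1..n}}"

text \<open>\<open>submat U V P\<close> is \<open>P\<^sub>U\<^sup>V\<close>, \<open>row_sub U P\<close> is \<open>P\<^sub>U\<close> and \<open>col_sub V P\<close> is \<open>P\<^sup>V\<close>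
  (for \<open>U \<subseteq> rows P\<close> and \<open>V \<subseteq> cols P\<close>).\<close>

definition submat :: "'a set \<Rightarrow> 'b set \<Rightarrow> ('a, 'b) lmat \<Rightarrow> ('a, 'b) lmat" where
  "submat U V P = lmat U V (entry P)"

definition row_sub :: "'a set \<Rightarrow> ('a, 'b) lmat \<Rightarrow> ('a, 'b) lmat" where
  "row_sub U P = submat U (cols P) P"

definition col_sub :: "'b set \<Rightarrow> ('a, 'b) lmat \<Rightarrow> ('a, 'b) lmat" where
  "col_sub V P = submat (rows P) V P"

definition transp_mat :: "('a, 'b) lmat \<Rightarrow> ('b, 'a) lmat" where
  "transp_mat P = lmat (cols P) (rows P) (\<lambda>j i. entry P i j)"

text \<open>Only meaningful when \<open>cols A = rows B\<close>.\<close>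

definition mat_times :: "('a, 'b) lmat \<Rightarrow> ('b, 'c) lmat \<Rightarrow> ('a, 'c) lmat" (infixl "**" 70) where
  "A ** B = lmat (rows A) (cols B) (\<lambda>i k. \<Sum>j\<in>cols A. entry A i j * entry B j k)"

text \<open>\<open>mat_prod Q k\<close> is the product \<open>Q 1 ** Q 2 ** \<dots> ** Q k\<close> for \<open>k \<ge> 1\<close>.\<close>

definition mat_prod :: "(nat \<Rightarrow> ('a, 'a) lmat) \<Rightarrow> nat \<Rightarrow> ('a, 'a) lmat" where
  "mat_prod Q k = foldl (**) (Q 1) (map Q [2..<Suc k])"

text \<open>The row vector \<open>e(m) = (1, \<dots>, 1)\<close>; the label \<open>r\<close> of its single row is a parameter, so that
  the column of its transpose can be matched with the row of the next factor.\<close>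

definition ones_row :: "'a \<Rightarrow> nat \<Rightarrow> ('a, nat) lmat" where
  "ones_row r m = lmat {r} {1..m} (\<lambda>_ _. 1)"

definition singletons :: "'a set \<Rightarrow> 'a set set" where
  "singletons K = (\<lambda>j. {j}) ` K"

definition gen_stochastic :: "('a, 'b) lmat \<Rightarrow> bool" where
  "gen_stochastic P \<longleftrightarrow> (\<exists>a. \<forall>i\<in>rows P. (\<Sum>j\<in>cols P. entry P i j) = a)"

text \<open>\<open>stable_on \<Delta> \<Sigma> P\<close>: \<open>P\<close> is \<open>[\<Delta>]\<close>-stable on \<open>\<Sigma>\<close>, where \<open>\<Delta>\<close> and \<open>\<Sigma>\<close> are partitions of the
  row and column index sets.\<close>

definition stable_on :: "'a set set \<Rightarrow> 'b set set \<Rightarrow> ('a, 'b) lmat \<Rightarrow> bool" where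
  "stable_on \<Delta> \<Sigma> P \<longleftrightarrow> (\<forall>U\<in>\<Delta>. \<forall>V\<in>\<Sigma>. gen_stochastic (submat U V P))"

definition G_hat :: "'a set set \<Rightarrow> 'b set set \<Rightarrow> ('a, 'b) lmat set" where
  "G_hat \<Delta> \<Sigma> = {P. partition_on (rows P) \<Delta> \<and> partition_on (cols P) \<Sigma> \<and> stable_on \<Delta> \<Sigma> P}"

definition stable_mat :: "('a, 'b) lmat \<Rightarrow> bool" where
  "stable_mat P \<longleftrightarrow> stable_on {rows P} (singletons (cols P)) P"

lemma stable_mat_iff_rows_identical:
  "stable_mat P \<longleftrightarrow> (\<forall>i\<in>rows P. \<forall>i'\<in>rows P. \<forall>j\<in>cols P. entry P i j = entry P i' j)"
proof -
  have "stable_mat P \<longleftrightarrow> (\<forall>j\<in>cols P. \<exists>a. \<forall>i\<in>rows P. entry P i j = a)"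
    by (simp add: stable_mat_def stable_on_def gen_stochastic_def submat_def singletons_def
        entry_lmat)
  also have "\<dots> \<longleftrightarrow> (\<forall>j\<in>cols P. \<forall>i\<in>rows P. \<forall>i'\<in>rows P. entry P i j = entry P i' j)"
    by (rule ball_cong) (rule refl, metis)
  finally show ?thesis
    by blast
qed

text \<open>The grouped matrix; the description operator picks the common value of the row sums, which
  exists for \<open>P \<in> G_hat \<Delta> \<Sigma>\<close> (see the lemma below).\<close>

definition grouped :: "'a set set \<Rightarrow> 'b set set \<Rightarrow> ('a, 'b) lmat \<Rightarrow> ('a set, 'b set) lmat" where
  "grouped \<Delta> \<Sigma> P = lmat \<Delta> \<Sigma> (\<lambda>U V. THE a. \<forall>i\<in>U. (\<Sum>j\<in>V. entry P i j) = a)"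

lemma entry_grouped:
  assumes P: "P \<in> G_hat \<Delta> \<Sigma>" and U: "U \<in> \<Delta>" and V: "V \<in> \<Sigma>" and i: "i \<in> U"
  shows "entry (grouped \<Delta> \<Sigma> P) U V = (\<Sum>j\<in>V. entry P i j)"
proof -
  have "gen_stochastic (submat U V P)"
    using P U V by (simp add: G_hat_def stable_on_def)
  then obtain a where a: "\<forall>i\<in>U. (\<Sum>j\<in>V. entry P i j) = a"
    by (auto simp: gen_stochastic_def submat_def entry_lmat)
  then have "(THE a. \<forall>i\<in>U. (\<Sum>j\<in>V. entry P i j) = a) = a"
    using i by (intro the_equality) auto
  then show ?thesis
    using U V i a by (simp add: grouped_def entry_lmat)
qed

text \<open>Equality of matrices up to identifying row label \<open>i\<close> with \<open>f i\<close> and column label \<open>j\<close>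
  with \<open>g j\<close>.\<close>

definition eq_upto ::
    "('a \<Rightarrow> 'c) \<Rightarrow> ('b \<Rightarrow> 'd) \<Rightarrow> ('a, 'b) lmat \<Rightarrow> ('c, 'd) lmat \<Rightarrow> bool" where
  "eq_upto f g A B \<longleftrightarrow> bij_betw f (rows A) (rows B) \<and> bij_betw g (cols A) (cols B) \<and>
     (\<forall>i\<in>rows A. \<forall>j\<in>cols A. entry A i j = entry B (f i) (g j))"

end

theory Submission
  imports Defs
begin

text \<open>
  The whole theorem rests on one fact: grouping is multiplicative.  If \<open>A\<close> is stable from \<open>\<Delta>\<close> to \<open>\<Sigma>\<close> and
  \<open>B\<close> is stable from \<open>\<Sigma>\<close> to \<open>\<Gamma>\<close>, then the sum of row \<open>i\<close> of \<open>A ** B\<close> over a block \<open>W\<close> of \<open>\<Gamma>\<close> is obtained by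
  first summing the rows of \<open>B\<close> over \<open>W\<close>; these sums depend only on the block of \<open>\<Sigma>\<close> that contains the
  row, so the sum over the intermediate index collapses to a sum over the blocks of \<open>\<Sigma>\<close>
  (\<open>block_sum_mat_times\<close>).  Hence \<open>A ** B\<close> is stable from \<open>\<Delta>\<close> to \<open>\<Gamma>\<close> and its grouped matrix is the product
  of the two grouped matrices; by induction the same holds for \<open>P\<^sub>1 \<cdots> P\<^sub>t\<close> (\<open>grouped_mat_prod\<close>).

  Now let the row partition have a single block and let the column partition contain \<open>{j}\<close> for every
  \<open>j \<in> K\<close>.  A row sum over the block \<open>{j}\<close> is just an entry of column \<open>j\<close>, so stability says that
  the columns in \<open>K\<close> are constant and that the constants are the entries of the single row of the grouped
  matrix (\<open>entry_eq_grouped_singleton\<close>).  This gives (a) and (b), and (c) restates it, because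
  multiplying a single row by a column of ones repeats that row.  The forms
  in which \<open>K\<close> is selected only in the last factor hold because the columns of a product depend
  only on the same columns of its last factor, and because deleting the columns outside \<open>K\<close> commutes
  with grouping when the columns in \<open>K\<close> are singleton blocks (\<open>col_sub_grouped\<close>).
\<close>

section \<open>Products of labelled matrices\<close>

lemma rows_mat_times [simp]: "rows (A ** B) = rows A"
  by (simp add: mat_times_def)

lemma cols_mat_times [simp]: "cols (A ** B) = cols B"
  by (simp add: mat_times_def)

lemma entry_mat_times:
  assumes "i \<in> rows A" and "k \<in> cols B"
  shows "entry (A ** B) i k = (\<Sum>j\<in>cols A. entry A i j * entry B j k)"
  using assms by (simp add: mat_times_def entry_lmat)

lemma mat_times_assoc:
  assumes "cols A = rows B"
  shows "A ** B ** C = A ** (B ** C)"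
proof (rule lmat_eqI)
  fix i l
  assume "i \<in> rows (A ** B ** C)" and "l \<in> cols (A ** B ** C)"
  then have i: "i \<in> rows A" and l: "l \<in> cols C"
    by simp_all
  have "entry (A ** B ** C) i l
      = (\<Sum>k\<in>cols B. \<Sum>j\<in>cols A. entry A i j * (entry B j k * entry C k l))"
    using i l by (simp add: entry_mat_times sum_distrib_right mult.assoc)
  also have "\<dots> = (\<Sum>j\<in>cols A. \<Sum>k\<in>cols B. entry A i j * (entry B j k * entry C k l))"
    by (rule sum.swap)
  also have "\<dots> = (\<Sum>j\<in>cols A. entry A i j * entry (B ** C) j l)"
    using l assms by (simp add: entry_mat_times sum_distrib_left)
  also have "\<dots> = entry (A ** (B ** C)) i l"
    using i l by (simp add: entry_mat_times)
  finally show "entry (A ** B ** C) i l = entry (A ** (B ** C)) i l" .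
qed simp_all

lemma mat_prod_1 [simp]: "mat_prod Q (Suc 0) = Q 1"
  by (simp add: mat_prod_def)

lemma mat_prod_Suc:
  assumes "k \<ge> 1"
  shows "mat_prod Q (Suc k) = mat_prod Q k ** Q (Suc k)"
  using assms by (simp add: mat_prod_def)

lemma rows_col_sub [simp]: "rows (col_sub V P) = rows P"
  by (simp add: col_sub_def submat_def)

lemma cols_col_sub [simp]: "cols (col_sub V P) = V"
  by (simp add: col_sub_def submat_def)

lemma entry_col_sub:
  assumes "i \<in> rows P" and "j \<in> V"
  shows "entry (col_sub V P) i j = entry P i j"
  using assms by (simp add: col_sub_def submat_def entry_lmat)

lemma col_sub_cols [simp]: "col_sub (cols P) P = P"
  by (rule lmat_eqI) (simp_all add: entry_col_sub)

lemma col_sub_mat_times: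
  assumes "cols A = rows B" and "V \<subseteq> cols B"
  shows "col_sub V (A ** B) = A ** col_sub V B"
proof (rule lmat_eqI)
  fix i k
  assume "i \<in> rows (col_sub V (A ** B))" and "k \<in> cols (col_sub V (A ** B))"
  then show "entry (col_sub V (A ** B)) i k = entry (A ** col_sub V B) i k"
    using assms by (auto simp: entry_col_sub entry_mat_times intro!: sum.cong)
qed simp_all

lemma rows_transp_ones [simp]: "rows (transp_mat (ones_row r m)) = {1..m}"
  by (simp add: transp_mat_def ones_row_def)

lemma cols_transp_ones [simp]: "cols (transp_mat (ones_row r m)) = {r}"
  by (simp add: transp_mat_def ones_row_def)

text \<open>Multiplying a one-row matrix by a column of ones repeats its row.\<close>

lemma entry_transp_ones_times:
  assumes "i \<in> {1..m}" and "j \<in> cols A"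
  shows "entry (transp_mat (ones_row r m) ** A) i j = entry A r j"
proof -
  have "entry (transp_mat (ones_row r m)) i r = 1"
    using assms by (simp add: transp_mat_def ones_row_def entry_lmat)
  then show ?thesis
    using assms by (subst entry_mat_times) simp_all
qed

section \<open>Grouping is multiplicative\<close>

lemma rows_grouped [simp]: "rows (grouped \<Delta> \<Sigma> P) = \<Delta>"
  by (simp add: grouped_def)

lemma cols_grouped [simp]: "cols (grouped \<Delta> \<Sigma> P) = \<Sigma>"
  by (simp add: grouped_def)

lemma stable_onI:
  assumes "\<And>U V i. U \<in> \<Delta> \<Longrightarrow> V \<in> \<Sigma> \<Longrightarrow> i \<in> U \<Longrightarrow> (\<Sum>j\<in>V. entry P i j) = s U V"
  shows "stable_on \<Delta> \<Sigma> P"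
  unfolding stable_on_def gen_stochastic_def submat_def
proof (intro ballI)
  fix U V
  assume "U \<in> \<Delta>" and "V \<in> \<Sigma>"
  then show "\<exists>a. \<forall>i\<in>rows (lmat U V (entry P)).
      (\<Sum>j\<in>cols (lmat U V (entry P)). entry (lmat U V (entry P)) i j) = a"
    using assms by (intro exI[of _ "s U V"]) (simp add: entry_lmat)
qed

text \<open>The key computation: within a block \<open>V\<close> of the intermediate partition, the block sums of the rows
  of \<open>B\<close> are all equal and factor out, leaving the block sum of row \<open>i\<close> of \<open>A\<close>.  The right-hand side
  depends on \<open>i\<close> only through its block \<open>U\<close>, which is what makes the product stable.\<close>

lemma block_sum_mat_times:
  assumes A: "A \<in> G_hat \<Delta> \<Sigma>" and B: "B \<in> G_hat \<Sigma> \<Gamma>"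
    and AB: "cols A = rows B" and fin: "finite (cols A)"
    and U: "U \<in> \<Delta>" and W: "W \<in> \<Gamma>" and i: "i \<in> U"
  shows "(\<Sum>k\<in>W. entry (A ** B) i k)
    = (\<Sum>V\<in>\<Sigma>. entry (grouped \<Delta> \<Sigma> A) U V * entry (grouped \<Sigma> \<Gamma> B) V W)"
proof -
  have part: "partition_on (cols A) \<Sigma>" and "partition_on (rows A) \<Delta>" "partition_on (cols B) \<Gamma>"
    using A B by (auto simp: G_hat_def)
  then have iA: "i \<in> rows A" and WB: "W \<subseteq> cols B"
    using U W i by (auto simp: partition_on_def)
  have fin_block: "\<forall>V\<in>\<Sigma>. finite V"
    using part fin by (metis partition_onD1 Union_upper finite_subset)
  have "(\<Sum>k\<in>W. entry (A ** B) i k) = (\<Sum>k\<in>W. \<Sum>j\<in>cols A. entry A i j * entry B j k)"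
    using iA WB by (intro sum.cong) (auto simp: entry_mat_times)
  also have "\<dots> = (\<Sum>j\<in>\<Union>\<Sigma>. entry A i j * (\<Sum>k\<in>W. entry B j k))"
    using partition_onD1[OF part] by (subst sum.swap) (simp add: sum_distrib_left)
  also have "\<dots> = (\<Sum>V\<in>\<Sigma>. \<Sum>j\<in>V. entry A i j * (\<Sum>k\<in>W. entry B j k))"
    using fin_block partition_onD2[OF part]
    by (subst sum.Union_disjoint) (auto simp: disjoint_def)
  also have "\<dots> = (\<Sum>V\<in>\<Sigma>. entry (grouped \<Delta> \<Sigma> A) U V * entry (grouped \<Sigma> \<Gamma> B) V W)"
  proof (rule sum.cong)
    fix V
    assume V: "V \<in> \<Sigma>"
    have "(\<Sum>j\<in>V. entry A i j * (\<Sum>k\<in>W. entry B j k))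
        = (\<Sum>j\<in>V. entry A i j * entry (grouped \<Sigma> \<Gamma> B) V W)"
      using entry_grouped[OF B V W] by (intro sum.cong) auto
    also have "\<dots> = entry (grouped \<Delta> \<Sigma> A) U V * entry (grouped \<Sigma> \<Gamma> B) V W"
      using entry_grouped[OF A U V i] by (simp add: sum_distrib_right)
    finally show "(\<Sum>j\<in>V. entry A i j * (\<Sum>k\<in>W. entry B j k))
        = entry (grouped \<Delta> \<Sigma> A) U V * entry (grouped \<Sigma> \<Gamma> B) V W" .
  qed simp
  finally show ?thesis .
qed

lemma mat_times_in_G_hat:
  assumes "A \<in> G_hat \<Delta> \<Sigma>" and "B \<in> G_hat \<Sigma> \<Gamma>" and "cols A = rows B" and "finite (cols A)"
  shows "A ** B \<in> G_hat \<Delta> \<Gamma>"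
proof -
  have "stable_on \<Delta> \<Gamma> (A ** B)"
    by (rule stable_onI) (rule block_sum_mat_times[OF assms])
  then show ?thesis
    using assms by (simp add: G_hat_def)
qed

lemma grouped_mat_times:
  assumes A: "A \<in> G_hat \<Delta> \<Sigma>" and B: "B \<in> G_hat \<Sigma> \<Gamma>"
    and AB: "cols A = rows B" and fin: "finite (cols A)"
  shows "grouped \<Delta> \<Gamma> (A ** B) = grouped \<Delta> \<Sigma> A ** grouped \<Sigma> \<Gamma> B"
proof (rule lmat_eqI)
  fix U W
  assume "U \<in> rows (grouped \<Delta> \<Gamma> (A ** B))" and "W \<in> cols (grouped \<Delta> \<Gamma> (A ** B))"
  then have U: "U \<in> \<Delta>" and W: "W \<in> \<Gamma>"
    by simp_all
  moreover have "{} \<notin> \<Delta>"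
    using A by (simp add: G_hat_def partition_on_def)
  \<comment> \<open>Blocks are nonempty, so every block sum of the product is witnessed by an actual row.\<close>
  ultimately obtain i where i: "i \<in> U"
    by fastforce
  show "entry (grouped \<Delta> \<Gamma> (A ** B)) U W = entry (grouped \<Delta> \<Sigma> A ** grouped \<Sigma> \<Gamma> B) U W"
    using entry_grouped[OF mat_times_in_G_hat[OF assms] U W i]
      block_sum_mat_times[OF assms U W i] U W
    by (simp add: entry_mat_times)
qed simp_all

lemma grouped_mat_prod:
  assumes P: "\<And>l. l \<in> {1..k} \<Longrightarrow> P l \<in> G_hat (\<Delta> l) (\<Delta> (l + 1))"
    and comp: "\<And>l. l \<in> {1..<k} \<Longrightarrow> cols (P l) = rows (P (l + 1))"
    and fin: "\<And>l. l \<in> {1..<k} \<Longrightarrow> finite (cols (P l))"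
    and k: "k \<ge> 1"
  shows "rows (mat_prod P k) = rows (P 1) \<and> cols (mat_prod P k) = cols (P k) \<and>
    mat_prod P k \<in> G_hat (\<Delta> 1) (\<Delta> (k + 1)) \<and>
    grouped (\<Delta> 1) (\<Delta> (k + 1)) (mat_prod P k)
      = mat_prod (\<lambda>b. grouped (\<Delta> b) (\<Delta> (b + 1)) (P b)) k"
  using k P comp fin
proof (induction k rule: dec_induct)
  case base
  then show ?case
    using base(1)[of 1] by simp
next
  case (step k)
  have IH: "rows (mat_prod P k) = rows (P 1)" "cols (mat_prod P k) = cols (P k)"
    "mat_prod P k \<in> G_hat (\<Delta> 1) (\<Delta> (k + 1))"
    "grouped (\<Delta> 1) (\<Delta> (k + 1)) (mat_prod P k)
      = mat_prod (\<lambda>b. grouped (\<Delta> b) (\<Delta> (b + 1)) (P b)) k"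
    using step by auto
  have last: "P (Suc k) \<in> G_hat (\<Delta> (k + 1)) (\<Delta> (k + 2))"
    using step.prems(1)[of "Suc k"] by simp
  have comp: "cols (mat_prod P k) = rows (P (Suc k))" and fin: "finite (cols (mat_prod P k))"
    using step.prems(2)[of k] step.prems(3)[of k] step.hyps IH by simp_all
  show ?case
    using IH mat_times_in_G_hat[OF IH(3) last comp fin] grouped_mat_times[OF IH(3) last comp fin]
      step.hyps
    by (simp add: mat_prod_Suc)
qed

section \<open>Columns that form singleton blocks\<close>

lemma mem_singletons: "j \<in> K \<Longrightarrow> {j} \<in> singletons K"
  by (simp add: singletons_def)

lemma bij_betw_singletons: "bij_betw (\<lambda>j. {j}) K (singletons K)"
  by (simp add: bij_betw_def singletons_def inj_on_def)

lemma entry_eq_grouped_singleton: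
  assumes "M \<in> G_hat \<Delta> \<Sigma>" and "singletons K \<subseteq> \<Sigma>" and "U \<in> \<Delta>" and "i \<in> U" and "j \<in> K"
  shows "entry M i j = entry (grouped \<Delta> \<Sigma> M) U {j}"
proof -
  have "{j} \<in> \<Sigma>"
    using assms(2) mem_singletons[OF assms(5)] by blast
  from entry_grouped[OF assms(1,3) this assms(4)] show ?thesis
    by simp
qed

text \<open>A row sum over the block \<open>{j}\<close> sees only column \<open>j\<close>, so the other columns may be deleted before or
  after grouping.\<close>

lemma col_sub_grouped:
  assumes "partition_on (rows P) \<Delta>" and "singletons K \<subseteq> \<Sigma>"
  shows "col_sub (singletons K) (grouped \<Delta> \<Sigma> P) = grouped \<Delta> (singletons K) (col_sub K P)"
proof (rule lmat_eqI)
  fix U V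
  assume "U \<in> rows (col_sub (singletons K) (grouped \<Delta> \<Sigma> P))"
    and "V \<in> cols (col_sub (singletons K) (grouped \<Delta> \<Sigma> P))"
  then have U: "U \<in> \<Delta>" and V: "V \<in> singletons K"
    by simp_all
  then obtain j where j: "j \<in> K" "V = {j}"
    by (auto simp: singletons_def)
  have "entry (col_sub K P) i j = entry P i j" if "i \<in> U" for i
    using that U j assms(1) by (intro entry_col_sub) (auto simp: partition_on_def)
  then show "entry (col_sub (singletons K) (grouped \<Delta> \<Sigma> P)) U V
      = entry (grouped \<Delta> (singletons K) (col_sub K P)) U V"
    using U V j assms(2) by (auto simp: entry_col_sub grouped_def entry_lmat)
qed simp_all

text \<open>The theorem for a single matrix: with one row block, the columns forming singleton blocks are constant, and
  their values are read off the grouped matrix.\<close>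

lemma one_block_singleton_columns:
  assumes M: "M \<in> G_hat {rows M} \<Sigma>" and K: "singletons K \<subseteq> \<Sigma>"
    and rows: "rows M = {1..m}"
  shows "stable_mat (col_sub K M)"
    and "i \<in> rows M \<Longrightarrow> eq_upto (\<lambda>_. rows M) (\<lambda>j. {j}) (submat {i} K M)
      (col_sub (singletons K) (grouped {rows M} \<Sigma> M))"
    and "eq_upto (\<lambda>i. i) (\<lambda>j. {j}) (col_sub K M)
      (transp_mat (ones_row (rows M) m) ** col_sub (singletons K) (grouped {rows M} \<Sigma> M))"
proof -
  let ?G = "grouped {rows M} \<Sigma> M"
  have entry: "entry M i j = entry (col_sub (singletons K) ?G) (rows M) {j}"
    if "i \<in> rows M" and "j \<in> K" for i j
    using entry_eq_grouped_singleton[OF M K _ that] that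
    by (simp add: entry_col_sub mem_singletons)
  show "stable_mat (col_sub K M)"
    using entry by (simp add: stable_mat_iff_rows_identical entry_col_sub)
  show "eq_upto (\<lambda>_. rows M) (\<lambda>j. {j}) (submat {i} K M) (col_sub (singletons K) ?G)"
    if "i \<in> rows M"
    using that entry bij_betw_singletons
    by (simp add: eq_upto_def submat_def entry_lmat bij_betw_def)
  have "entry (col_sub K M) i j
      = entry (transp_mat (ones_row (rows M) m) ** col_sub (singletons K) ?G) i {j}"
    if "i \<in> rows M" and "j \<in> K" for i j
    using that entry[OF that] rows
    by (simp add: entry_col_sub entry_transp_ones_times mem_singletons)
  then show "eq_upto (\<lambda>i. i) (\<lambda>j. {j}) (col_sub K M)
      (transp_mat (ones_row (rows M) m) ** col_sub (singletons K) ?G)"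
    using bij_betw_singletons rows by (simp add: eq_upto_def bij_betw_def)
qed

section \<open>Products of stable matrices\<close>

theorem theorem1p10:
  fixes t :: nat and n :: "nat \<Rightarrow> nat" and \<Delta> :: "nat \<Rightarrow> nat set set"
    and P :: "nat \<Rightarrow> (nat, nat) lmat" and K Kc :: "nat set"
    and G :: "nat \<Rightarrow> (nat set, nat set) lmat" and GK :: "(nat set, nat set) lmat"
    and e' :: "(nat, nat set) lmat"
  assumes "t \<ge> 2"
    and "\<And>l. l \<in> {1..t+1} \<Longrightarrow> n l \<ge> 1"
    and "\<And>l. l \<in> {1..t+1} \<Longrightarrow> partition_on {1..n l} (\<Delta> l)"
    and "\<And>l. l \<in> {1..t} \<Longrightarrow> P l \<in> C_mat (n l) (n (l+1))"
    and "\<And>l. l \<in> {1..t} \<Longrightarrow> P l \<in> G_hat (\<Delta> l) (\<Delta> (l+1))"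
    and "K \<noteq> {}" and "K \<subseteq> {1..n (t+1)}"
    and "Kc = {1..n (t+1)} - K"
    and "\<Delta> 1 = {{1..n 1}}"
    and "\<Delta> (t+1) = singletons K \<union> (if Kc = {} then {} else {Kc})"
    and "G = (\<lambda>b. grouped (\<Delta> b) (\<Delta> (b+1)) (P b))"
    and "GK = grouped (\<Delta> t) (singletons K) (col_sub K (P t))"
    and "e' = transp_mat (ones_row {1..n 1} (n 1))"
  shows
    \<comment> \<open>(a)\<close>
    "(stable_mat (col_sub K (mat_prod P t)) \<and>
      col_sub K (mat_prod P t) = mat_prod P (t-1) ** col_sub K (P t)) \<and>
    \<comment> \<open>(b)\<close>
    (\<forall>i\<in>{1..n 1}.
      eq_upto (\<lambda>_. {1..n 1}) (\<lambda>j. {j})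
        (submat {i} K (mat_prod P t)) (col_sub (singletons K) (mat_prod G t)) \<and>
      col_sub (singletons K) (mat_prod G t) = mat_prod G (t-1) ** GK) \<and>
    \<comment> \<open>(c)\<close>
    (eq_upto (\<lambda>i. i) (\<lambda>j. {j})
        (col_sub K (mat_prod P t)) (e' ** col_sub (singletons K) (mat_prod G t)) \<and>
      e' ** col_sub (singletons K) (mat_prod G t) = e' ** mat_prod G (t-1) ** GK) \<and>
    \<comment> \<open>the case where K is the whole column index set\<close>
    (K = {1..n (t+1)} \<longrightarrow>
      stable_mat (mat_prod P t) \<and>
      (\<forall>i\<in>{1..n 1}. eq_upto (\<lambda>_. {1..n 1}) (\<lambda>j. {j})
        (row_sub {i} (mat_prod P t)) (mat_prod G t)) \<and>
      eq_upto (\<lambda>i. i) (\<lambda>j. {j}) (mat_prod P t) (e' ** mat_prod G t))"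
proof -
  let ?M = "mat_prod P t" and ?R = "{1..n 1}"
  have rows_P: "rows (P l) = {1..n l}" and cols_P: "cols (P l) = {1..n (l + 1)}"
    if "l \<in> {1..t}" for l
    using assms(4)[OF that] by (simp_all add: C_mat_def)
  have prod: "rows (mat_prod P k) = ?R" "cols (mat_prod P k) = {1..n (k + 1)}"
    "mat_prod P k \<in> G_hat {?R} (\<Delta> (k + 1))"
    "grouped {?R} (\<Delta> (k + 1)) (mat_prod P k) = mat_prod G k"
    if "k \<in> {1..t}" for k
    using grouped_mat_prod[of k P \<Delta>] that assms(5) rows_P cols_P
    unfolding assms(9,11) by simp_all
  have M: "rows ?M = ?R" "cols ?M = {1..n (t + 1)}" "?M \<in> G_hat {?R} (\<Delta> (t + 1))"
    and GM: "grouped {?R} (\<Delta> (t + 1)) ?M = mat_prod G t"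
    using prod[of t] assms(1) by simp_all
  have K: "singletons K \<subseteq> \<Delta> (t + 1)"
    using assms(10) by simp
  note columns = one_block_singleton_columns[of ?M, unfolded M(1), OF M(3) K refl, unfolded GM]
  have split: "mat_prod Q t = mat_prod Q (t - 1) ** Q t" for Q :: "nat \<Rightarrow> ('a, 'a) lmat"
    using mat_prod_Suc[of "t - 1" Q] assms(1) by simp
  have G_init: "rows (mat_prod G (t - 1)) = {?R}" "cols (mat_prod G (t - 1)) = \<Delta> t"
    using prod(4)[of "t - 1", symmetric] assms(1) by simp_all
  have last_P: "col_sub K ?M = mat_prod P (t - 1) ** col_sub K (P t)"
    unfolding split[of P] using prod(2)[of "t - 1"] rows_P[of t] cols_P[of t] assms(1,7)
    by (intro col_sub_mat_times) simp_all
  have "partition_on (rows (P t)) (\<Delta> t)"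
    using assms(1) assms(3)[of t] rows_P[of t] by simp
  then have "col_sub (singletons K) (G t) = GK"
    unfolding assms(11,12) using K by (rule col_sub_grouped)
  moreover have "col_sub (singletons K) (mat_prod G t)
      = mat_prod G (t - 1) ** col_sub (singletons K) (G t)"
    unfolding split[of G] using G_init K assms(11) by (intro col_sub_mat_times) simp_all
  ultimately have last_G: "col_sub (singletons K) (mat_prod G t) = mat_prod G (t - 1) ** GK"
    by simp
  have last_eG: "e' ** col_sub (singletons K) (mat_prod G t) = e' ** mat_prod G (t - 1) ** GK"
    unfolding last_G using G_init assms(13) by (intro mat_times_assoc[symmetric]) simp
  have full: "col_sub K ?M = ?M" "submat {i} K ?M = row_sub {i} ?M"
    "col_sub (singletons K) (mat_prod G t) = mat_prod G t" if "K = {1..n (t + 1)}" for i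
  proof -
    have "singletons K = \<Delta> (t + 1)"
      using that assms(8,10) by simp
    then show "col_sub (singletons K) (mat_prod G t) = mat_prod G t"
      using col_sub_cols[of "mat_prod G t"] GM[symmetric] by simp
    show "col_sub K ?M = ?M" "submat {i} K ?M = row_sub {i} ?M"
      using that M(2) col_sub_cols[of ?M] by (simp_all add: row_sub_def)
  qed
  have eq: "eq_upto (\<lambda>_. ?R) (\<lambda>j. {j}) (submat {i} K ?M) (col_sub (singletons K) (mat_prod G t))"
    if "i \<in> ?R" for i
    using columns(2)[OF that] .
  have eq_e: "eq_upto (\<lambda>i. i) (\<lambda>j. {j}) (col_sub K ?M)
      (e' ** col_sub (singletons K) (mat_prod G t))"
    unfolding assms(13) by (rule columns(3))
  show ?thesis
  proof (intro conjI ballI impI)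
    show "stable_mat ?M" if "K = {1..n (t + 1)}"
      using columns(1) unfolding full(1)[OF that] .
    show "eq_upto (\<lambda>_. ?R) (\<lambda>j. {j}) (row_sub {i} ?M) (mat_prod G t)"
      if "K = {1..n (t + 1)}" and "i \<in> ?R" for i
      using eq[OF that(2)] unfolding full(2,3)[OF that(1)] .
    show "eq_upto (\<lambda>i. i) (\<lambda>j. {j}) ?M (e' ** mat_prod G t)" if "K = {1..n (t + 1)}"
      using eq_e unfolding full(1,3)[OF that] .
  qed (rule columns(1) last_P last_G last_eG eq_e | erule eq)+
qed

end
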